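(* Let $A$ be a real $m\times n$ matrix and let $f,s\in\mathbb{R}^n$ be vectors with the same support $\mathcal{I}$ such that $\ell_1$ recovery fails for $f$ and succeeds for $s$. Assume that $\mathrm{rank}(A_{\mathcal{I}})=|\mathcal{I}|$ and that there exists $y\in\mathbb{R}^m$ with $$y^TA^{\downarrow j}=\mathrm{sign}(s_j)\ \text{ for all } j\in\mathcal{I},\qquad |y^TA^{\downarrow j}|<1\ \text{ for all } j\notin\mathcal{I}.$$ For $\gamma\in\mathbb{R}$ let $X_0(\gamma)=[(1-\gamma)s,\ \gamma f]\in\mathbb{R}^{n\times 2}$. Then for all sufficiently small $\gamma>0$, $X_0(\gamma)$ can be recovered from $B=AX_0(\gamma)$ using $\ell_{1,2}$, i.e. it is the unique solution of $$\min_{X\in\mathbb{R}^{n\times 2}}\ \|X\|_{1,2}\quad\text{subject to}\quad AX=B,$$ whereas it cannot be recovered using $\ell_{1,1}$, i.e. it is not the unique solution of $$\min_{X\in\mathbb{R}^{n\times 2}}\ \|X\|_{1,1}\quad\text{subject to}\quad AX=B.$$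
   Context: The support of $x\in\mathbb{R}^n$ is $\{j\mid x_j\ne0\}$. $A^{\downarrow j}$ is the $j$th column of $A$, and $A_{\mathcal{I}}$ is the submatrix of $A$ formed by the columns indexed by $\mathcal{I}$. $\ell_1$ recovery succeeds for $x_0\in\mathbb{R}^n$ if $x_0$ is the unique solution of $\min_{x}\|x\|_1$ subject to $Ax=Ax_0$, and fails otherwise. For $X\in\mathbb{R}^{n\times r}$ with rows $X^{j\rightarrow}\in\mathbb{R}^r$, $\|X\|_{1,q}=\sum_{j=1}^n\|X^{j\rightarrow}\|_q$ for $q=1,2$. *)

theory Defs
  imports "HOL-Analysis.Analysis"
begin

definition support :: "real ^ 'n \<Rightarrow> 'n set" where
  "support x = {j. x $ j \<noteq> 0}"

text \<open>The rank of the submatrix of \<open>A\<close> formed by the columns indexed by \<open>I\<close>, as the dimension of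
  the space spanned by these columns. The index set \<open>I\<close> is not a type, so the submatrix itself is
  not of the form \<^typ>\<open>real ^ 'k ^ 'm\<close>; the two lemmas below relate the definition to
  \<^const>\<open>rank\<close>.\<close>

definition column_submatrix_rank :: "real ^ 'n ^ 'm \<Rightarrow> 'n set \<Rightarrow> nat" where
  "column_submatrix_rank A I = dim ((\<lambda>j. column j A) ` I)"

lemma column_submatrix_rank_UNIV: "column_submatrix_rank A UNIV = rank A"
proof -
  have "(\<lambda>j. column j A) ` UNIV = columns A"
    by (auto simp: columns_def)
  then show ?thesis
    by (simp add: column_submatrix_rank_def column_rank_def)
qed

lemma column_submatrix_rank_reindex:
  fixes A :: "real ^ 'n ^ 'm" and g :: "'k::finite \<Rightarrow> 'n"
  assumes "bij_betw g UNIV I"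
  shows "column_submatrix_rank A I = rank (\<chi> i k. A $ i $ g k)"
proof -
  have "(\<lambda>j. column j A) ` I = columns (\<chi> i k. A $ i $ g k)"
    using assms by (auto simp: columns_def column_def bij_betw_def image_image)
  then show ?thesis
    by (simp add: column_submatrix_rank_def column_rank_def)
qed

definition lq_norm :: "nat \<Rightarrow> real ^ 'n \<Rightarrow> real" where
  "lq_norm q x = root q (\<Sum>j\<in>UNIV. \<bar>x $ j\<bar> ^ q)"

lemma lq_norm_1: "lq_norm 1 x = (\<Sum>j\<in>UNIV. \<bar>x $ j\<bar>)"
  by (simp add: lq_norm_def)

lemma lq_norm_2: "lq_norm 2 x = norm x"
  by (simp add: lq_norm_def norm_vec_def L2_set_def sqrt_def)

definition mixed_norm :: "nat \<Rightarrow> real ^ 'r ^ 'n \<Rightarrow> real" where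
  "mixed_norm q X = (\<Sum>j\<in>UNIV. lq_norm q (row j X))"

definition unique_minimizer :: "('a \<Rightarrow> real) \<Rightarrow> ('a \<Rightarrow> bool) \<Rightarrow> 'a \<Rightarrow> bool" where
  "unique_minimizer N P x0 \<longleftrightarrow> (\<forall>x. is_arg_min N P x \<longleftrightarrow> x = x0)"

definition l1_recovery_succeeds :: "real ^ 'n ^ 'm \<Rightarrow> real ^ 'n \<Rightarrow> bool" where
  "l1_recovery_succeeds A x0 \<longleftrightarrow> unique_minimizer (lq_norm 1) (\<lambda>x. A *v x = A *v x0) x0"

abbreviation l1_recovery_fails :: "real ^ 'n ^ 'm \<Rightarrow> real ^ 'n \<Rightarrow> bool" where
  "l1_recovery_fails A x0 \<equiv> \<not> l1_recovery_succeeds A x0"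

definition mixed_recovery_succeeds :: "nat \<Rightarrow> real ^ 'n ^ 'm \<Rightarrow> real ^ 'r ^ 'n \<Rightarrow> bool" where
  "mixed_recovery_succeeds q A X0 \<longleftrightarrow> unique_minimizer (mixed_norm q) (\<lambda>X. A ** X = A ** X0) X0"

definition two_columns :: "real ^ 'n \<Rightarrow> real ^ 'n \<Rightarrow> real ^ 2 ^ 'n" where
  "two_columns u v = (\<chi> j. vector [u $ j, v $ j])"

end

theory Submission
  imports Defs
begin

text \<open>A matrix \<open>Y\<close> such that the rows of \<open>A\<^sup>T Y\<close> are the normalized rows of \<open>X\<^sub>0\<close> on the row support
  of \<open>X\<^sub>0\<close> and have norm less than 1 elsewhere certifies that \<open>X\<^sub>0\<close> is the unique
  \<open>\<ell>\<^sub>1\<^sub>,\<^sub>2\<close> minimizer. As \<open>\<gamma>\<close> tends to 0, the normalized rows of \<open>X\<^sub>0(\<gamma>)\<close> tend to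
  \<open>(sign s\<^sub>j, 0)\<close>, for which \<open>[y, 0]\<close> is such a certificate. The columns of \<open>A\<close> indexed by the
  support being independent, the certificate can be corrected by a term tending to 0, so the strict
  inequalities survive for small \<open>\<gamma>\<close>. The \<open>\<ell>\<^sub>1\<^sub>,\<^sub>1\<close> problem, on the other hand, decouples into
  \<open>\<ell>\<^sub>1\<close> problems for the two columns, and the one for \<open>\<gamma> f\<close> fails.\<close>

lemma unique_minimizer_altdef:
  fixes N :: "'a \<Rightarrow> real"
  shows "unique_minimizer N P x0 \<longleftrightarrow> P x0 \<and> (\<forall>x. P x \<longrightarrow> x \<noteq> x0 \<longrightarrow> N x0 < N x)"
proof
  assume u: "unique_minimizer N P x0"
  then have x0: "P x0" "\<And>x. P x \<Longrightarrow> N x0 \<le> N x"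
    unfolding unique_minimizer_def is_arg_min_linorder by blast+
  moreover have "x = x0" if "P x" "N x \<le> N x0" for x
    using u that x0 order_trans[of "N x" "N x0"]
    unfolding unique_minimizer_def is_arg_min_linorder by blast
  ultimately show "P x0 \<and> (\<forall>x. P x \<longrightarrow> x \<noteq> x0 \<longrightarrow> N x0 < N x)"
    using linorder_not_le by blast
next
  assume "P x0 \<and> (\<forall>x. P x \<longrightarrow> x \<noteq> x0 \<longrightarrow> N x0 < N x)"
  then show "unique_minimizer N P x0"
    unfolding unique_minimizer_def is_arg_min_def by (metis less_asym less_irrefl)
qed

lemma mixed_norm_2: "mixed_norm 2 X = (\<Sum>j\<in>UNIV. norm (X $ j))"
  by (simp add: mixed_norm_def lq_norm_2 row_def vec_lambda_eta)

lemma mixed_norm_1_two_columns: "mixed_norm 1 (two_columns u v) = lq_norm 1 u + lq_norm 1 v"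
  unfolding mixed_norm_def lq_norm_1
  by (simp add: row_def two_columns_def sum_2 sum.distrib)

lemma matrix_mult_two_columns: "A ** two_columns u v = two_columns (A *v u) (A *v v)"
  by (simp add: vec_eq_iff two_columns_def matrix_matrix_mult_def matrix_vector_mult_def forall_2)

lemma two_columns_eq_iff: "two_columns u v = two_columns u' v' \<longleftrightarrow> u = u' \<and> v = v'"
  by (auto simp: vec_eq_iff two_columns_def forall_2)

text \<open>Duality: the functional given by \<open>transpose A ** Y\<close> sees \<open>X\<close>
  only through \<open>A ** X\<close>, so it is constant on the feasible set.\<close>

lemma inner_transpose_matrix_mult:
  fixes A :: "real ^ 'n ^ 'm" and Y :: "real ^ 'r ^ 'm" and X :: "real ^ 'r ^ 'n"
  shows "(transpose A ** Y) \<bullet> X = Y \<bullet> (A ** X)"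
proof -
  have "(transpose A ** Y) \<bullet> X = (\<Sum>j\<in>UNIV. \<Sum>k\<in>UNIV. \<Sum>i\<in>UNIV. A $ i $ j * Y $ i $ k * X $ j $ k)"
    by (simp add: inner_vec_def matrix_matrix_mult_def transpose_def sum_distrib_right)
  also have "\<dots> = (\<Sum>j\<in>UNIV. \<Sum>i\<in>UNIV. \<Sum>k\<in>UNIV. A $ i $ j * Y $ i $ k * X $ j $ k)"
    by (intro sum.cong sum.swap refl)
  also have "\<dots> = (\<Sum>i\<in>UNIV. \<Sum>j\<in>UNIV. \<Sum>k\<in>UNIV. A $ i $ j * Y $ i $ k * X $ j $ k)"
    by (rule sum.swap)
  also have "\<dots> = (\<Sum>i\<in>UNIV. \<Sum>k\<in>UNIV. \<Sum>j\<in>UNIV. A $ i $ j * Y $ i $ k * X $ j $ k)"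
    by (intro sum.cong sum.swap refl)
  also have "\<dots> = Y \<bullet> (A ** X)"
    by (simp add: inner_vec_def matrix_matrix_mult_def sum_distrib_left mult_ac)
  finally show ?thesis .
qed

text \<open>Full rank makes the columns indexed by \<open>I\<close> distinct and independent, so a
  linear map can be prescribed freely on them. The matrix \<open>G\<close> serves twice: for
  uniqueness of the minimizer and for correcting the dual certificate.\<close>

lemma partial_left_inverse_exists:
  fixes A :: "real ^ 'n ^ 'm"
  assumes "column_submatrix_rank A I = card I"
  obtains G :: "real ^ 'm ^ 'n" where "\<And>j. j \<in> I \<Longrightarrow> column j (G ** A) = axis j 1"
proof -
  let ?c = "\<lambda>j. column j A"
  have dim: "dim (?c ` I) = card I"
    using assms by (simp add: column_submatrix_rank_def)
  have "dim (?c ` I) \<le> card (?c ` I)" "card (?c ` I) \<le> card I"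
    by (auto intro: dim_le_card' card_image_le)
  \<comment> \<open>The rank is taken over a set of columns, where repeated columns would collapse;
    the cardinality count excludes this.\<close>
  with dim have card: "card (?c ` I) = card I" by simp
  then have inj: "inj_on ?c I"
    by (simp add: eq_card_imp_inj_on)
  have "independent (?c ` I)"
    using card_le_dim_spanning[of "?c ` I" "span (?c ` I)"] dim card
    by (simp add: span_superset dim_span)
  then obtain g :: "real ^ 'm \<Rightarrow> real ^ 'n"
    where g: "linear g" "\<forall>x\<in>?c ` I. g x = axis (inv_into I ?c x) 1"
    using linear_independent_extend[of "?c ` I" "\<lambda>x. axis (inv_into I ?c x) 1"] by auto
  have "column j (matrix g ** A) = axis j 1" if "j \<in> I" for j
  proof -
    have "column j (matrix g ** A) = matrix g *v column j A"
      by (simp add: vec_eq_iff column_def matrix_matrix_mult_def matrix_vector_mult_def)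
    also have "\<dots> = axis j 1"
      using g that inv_into_f_f[OF inj that] by (simp add: matrix_works)
    finally show ?thesis .
  qed
  then show thesis by (rule that)
qed

text \<open>With \<open>Z = transpose A ** Y\<close>, every feasible \<open>X\<close> satisfies
  \<open>mixed_norm 2 X0 = Z \<bullet> X0 = Z \<bullet> X \<le> mixed_norm 2 X\<close> by
  Cauchy-Schwarz in each row. The inequality is strict as soon as \<open>X\<close> has a nonzero row
  outside \<open>I\<close>, and \<open>G\<close> forces such a row when
  \<open>X \<noteq> X0\<close>.\<close>

lemma mixed_recovery_succeeds_2I:
  fixes A :: "real ^ 'n ^ 'm" and X0 :: "real ^ 'r ^ 'n" and Y :: "real ^ 'r ^ 'm"
  assumes on: "\<And>j. j \<in> I \<Longrightarrow> (transpose A ** Y) $ j = sgn (X0 $ j)"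
    and off: "\<And>j. j \<notin> I \<Longrightarrow> norm ((transpose A ** Y) $ j) < 1"
    and supp: "\<And>j. j \<notin> I \<Longrightarrow> X0 $ j = 0"
    and G: "\<And>j. j \<in> I \<Longrightarrow> column j (G ** A) = axis j 1"
  shows "mixed_recovery_succeeds 2 A X0"
  unfolding mixed_recovery_succeeds_def unique_minimizer_altdef
proof (intro conjI allI impI refl)
  fix X assume feas: "A ** X = A ** X0" and ne: "X \<noteq> X0"
  let ?Z = "transpose A ** Y"
  have nz: "norm (?Z $ j) \<le> 1" for j
    using on off by (cases "j \<in> I") (auto simp: norm_sgn less_imp_le)
  have le: "?Z $ j \<bullet> X $ j \<le> norm (X $ j)" for j
    using norm_cauchy_schwarz[of "?Z $ j" "X $ j"] mult_right_mono[OF nz[of j], of "norm (X $ j)"]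
    by simp
  have eq0: "?Z $ j \<bullet> X0 $ j = norm (X0 $ j)" for j
    by (cases "X0 $ j = 0"; cases "j \<in> I")
      (simp_all add: on supp sgn_div_norm dot_square_norm power2_eq_square)
  \<comment> \<open>Otherwise the difference \<open>D\<close> has all its nonzero rows in
    \<open>I\<close>, where \<open>G ** A\<close> acts as the identity, so \<open>A ** D = 0\<close>
    gives \<open>D = 0\<close>.\<close>
  obtain j where j: "j \<notin> I" "X $ j \<noteq> 0"
  proof (rule ccontr)
    assume "\<not> thesis"
    with that have X: "X $ j = 0" if "j \<notin> I" for j using \<open>j \<notin> I\<close> by blast
    define D where "D = X - X0"
    have D: "D $ j = 0" if "j \<notin> I" for j
      using that by (simp add: D_def X supp)
    have "A ** D = 0"
      using feas matrix_add_ldistrib[of A D X0] by (simp add: D_def)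
    then have "(G ** A) ** D = 0"
      by (simp add: matrix_mul_assoc[symmetric])
    moreover have "((G ** A) ** D) $ i $ k = D $ i $ k" for i k
    proof -
      have "((G ** A) ** D) $ i $ k = (\<Sum>j\<in>UNIV. (G ** A) $ i $ j * D $ j $ k)"
        by (simp add: matrix_matrix_mult_def)
      also have "\<dots> = (\<Sum>j\<in>UNIV. if j = i then D $ i $ k else 0)"
      proof (rule sum.cong[OF refl])
        fix j
        show "(G ** A) $ i $ j * D $ j $ k = (if j = i then D $ i $ k else 0)"
        proof (cases "j \<in> I")
          case True
          then have "(G ** A) $ i $ j = axis j 1 $ i"
            using G[of j] by (metis column_def vec_lambda_beta)
          then show ?thesis by (auto simp: axis_def)
        qed (auto simp: D)
      qed
      finally show ?thesis by simp
    qed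
    ultimately have "D = 0" by (simp add: vec_eq_iff)
    with ne show False by (simp add: D_def)
  qed
  have "?Z $ j \<bullet> X $ j \<le> norm (?Z $ j) * norm (X $ j)"
    by (rule norm_cauchy_schwarz)
  also have "\<dots> < norm (X $ j)" using off[OF j(1)] j(2) by simp
  finally have lt: "?Z $ j \<bullet> X $ j < norm (X $ j)" .
  have "mixed_norm 2 X0 = ?Z \<bullet> X0"
    by (simp add: mixed_norm_2 inner_vec_def[of ?Z] eq0)
  also have "\<dots> = ?Z \<bullet> X"
    by (simp add: inner_transpose_matrix_mult feas)
  also have "\<dots> < mixed_norm 2 X"
    unfolding mixed_norm_2 inner_vec_def[of ?Z]
    by (rule sum_strict_mono_ex1) (use le lt in auto)
  finally show "mixed_norm 2 X0 < mixed_norm 2 X" .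
qed

text \<open>Both the norm and the constraint split over the columns, so a competitor for
  \<open>v\<close> becomes one for the pair by keeping \<open>u\<close> fixed.\<close>

lemma mixed_recovery_succeeds_1_two_columnsD:
  assumes "mixed_recovery_succeeds 1 A (two_columns u v)"
  shows "l1_recovery_succeeds A v"
  unfolding l1_recovery_succeeds_def unique_minimizer_altdef
proof (intro conjI allI impI refl)
  fix x assume "A *v x = A *v v" "x \<noteq> v"
  then have "mixed_norm 1 (two_columns u v) < mixed_norm 1 (two_columns u x)"
    using assms unfolding mixed_recovery_succeeds_def unique_minimizer_altdef
    by (simp add: matrix_mult_two_columns two_columns_eq_iff)
  then show "lq_norm 1 v < lq_norm 1 x"
    unfolding mixed_norm_1_two_columns by simp
qed

lemma lq_norm_1_scaleR: "lq_norm 1 (c *\<^sub>R x) = \<bar>c\<bar> * lq_norm 1 x"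
  unfolding lq_norm_1 by (simp add: abs_mult sum_distrib_left)

text \<open>Scaling by \<open>c\<close> maps feasible points to feasible points and multiplies the
  norm by \<open>\<bar>c\<bar> > 0\<close>. The converse is the same implication for
  \<open>inverse c\<close>.\<close>

lemma l1_recovery_succeeds_scaleR_iff:
  assumes "c \<noteq> 0"
  shows "l1_recovery_succeeds A (c *\<^sub>R x) \<longleftrightarrow> l1_recovery_succeeds A x"
proof -
  have imp: "l1_recovery_succeeds A (c *\<^sub>R x)"
    if x: "l1_recovery_succeeds A x" and c: "c \<noteq> 0" for c x
    unfolding l1_recovery_succeeds_def unique_minimizer_altdef
  proof (intro conjI allI impI refl)
    fix z assume z: "A *v z = A *v (c *\<^sub>R x)" "z \<noteq> c *\<^sub>R x"
    define w where "w = inverse c *\<^sub>R z"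
    have zw: "z = c *\<^sub>R w" using c by (simp add: w_def)
    have "A *v w = A *v x" "w \<noteq> x"
      using z c by (auto simp: zw scaleR_matrix_vector_assoc[symmetric] matrix_vector_mult_scaleR)
    then have "lq_norm 1 x < lq_norm 1 w"
      using x unfolding l1_recovery_succeeds_def unique_minimizer_altdef by blast
    then show "lq_norm 1 (c *\<^sub>R x) < lq_norm 1 z"
      unfolding zw lq_norm_1_scaleR using c by simp
  qed
  show ?thesis
    using imp[of x c] imp[of "c *\<^sub>R x" "inverse c"] assms by auto
qed

theorem mainTheorem5:
  fixes A :: "real ^ 'n ^ 'm" and f s :: "real ^ 'n" and I :: "'n set"
    and X0 :: "real \<Rightarrow> real ^ 2 ^ 'n"
  assumes "support f = I" and "support s = I"
    and "l1_recovery_fails A f" and "l1_recovery_succeeds A s"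
    and "column_submatrix_rank A I = card I"
    and "\<exists>y :: real ^ 'm. (\<forall>j\<in>I. y \<bullet> column j A = sgn (s $ j)) \<and>
                          (\<forall>j. j \<notin> I \<longrightarrow> \<bar>y \<bullet> column j A\<bar> < 1)"
    and "\<And>\<gamma>. X0 \<gamma> = two_columns ((1 - \<gamma>) *\<^sub>R s) (\<gamma> *\<^sub>R f)"
  shows "\<forall>\<^sub>F \<gamma> in at_right 0. mixed_recovery_succeeds 2 A (X0 \<gamma>) \<and>
                              \<not> mixed_recovery_succeeds 1 A (X0 \<gamma>)"
proof -
  obtain y :: "real ^ 'm" where y: "\<And>j. j \<in> I \<Longrightarrow> y \<bullet> column j A = sgn (s $ j)"
    "\<And>j. j \<notin> I \<Longrightarrow> \<bar>y \<bullet> column j A\<bar> < 1"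
    using assms(6) by blast
  obtain G :: "real ^ 'm ^ 'n" where G: "\<And>j. j \<in> I \<Longrightarrow> column j (G ** A) = axis j 1"
    using partial_left_inverse_exists[OF assms(5)] by blast
  have supp: "X0 \<gamma> $ j = 0" if "j \<notin> I" for \<gamma> j
  proof -
    have "f $ j = 0" "s $ j = 0"
      using that assms(1,2) by (auto simp: support_def)
    then show ?thesis
      by (simp add: assms(7) two_columns_def vec_eq_iff forall_2)
  qed
  define C :: "real \<Rightarrow> real ^ 2 ^ 'n" where "C \<gamma> = (\<chi> j. sgn (X0 \<gamma> $ j))" for \<gamma>
  define Y0 where "Y0 = two_columns y 0"
  \<comment> \<open>Since \<open>transpose A ** transpose G\<close> preserves the rows in
    \<open>I\<close>, this correction turns the values \<open>C 0\<close> of the certificate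
    \<open>Y0\<close> there into the required \<open>C \<gamma>\<close>, and it vanishes at
    \<open>\<gamma> = 0\<close>.\<close>
  define Y where "Y \<gamma> = Y0 + transpose G ** (C \<gamma> - C 0)" for \<gamma>
  have Y0: "(transpose A ** Y0) $ j = vector [y \<bullet> column j A, 0]" for j
    by (simp add: Y0_def two_columns_def vec_eq_iff forall_2 matrix_matrix_mult_def transpose_def
        inner_vec_def column_def mult.commute)
  have norm_pair: "norm (vector [a, 0] :: real ^ 2) = \<bar>a\<bar>" for a
    by (simp add: norm_vec_def L2_set_def sum_2)
  have C0: "C 0 $ j = vector [sgn (s $ j), 0]" for j
  proof -
    have "X0 0 $ j = vector [s $ j, 0]"
      by (simp add: assms(7) two_columns_def)
    then show ?thesis
      by (simp add: C_def sgn_div_norm norm_pair) (simp add: vec_eq_iff forall_2)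
  qed
  have AG: "(transpose A ** (transpose G ** M)) $ j = M $ j" if "j \<in> I"
    for j and M :: "real ^ 2 ^ 'n"
  proof -
    have "(transpose A ** (transpose G ** M)) $ j = (transpose (G ** A) ** M) $ j"
      by (simp add: matrix_transpose_mul matrix_mul_assoc)
    also have "\<dots> = (\<chi> k. \<Sum>i\<in>UNIV. column j (G ** A) $ i * M $ i $ k)"
      unfolding matrix_matrix_mult_def[of "transpose (G ** A)" M]
      by (simp add: vec_eq_iff transpose_def column_def)
    also have "\<dots> = M $ j"
      by (simp add: G[OF that] vec_eq_iff axis_def if_distrib[of "\<lambda>x. x * _"] cong: if_cong)
    finally show ?thesis .
  qed
  have Y_split: "transpose A ** Y \<gamma> = transpose A ** Y0 + transpose A ** (transpose G ** (C \<gamma> - C 0))" for \<gamma>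
    by (simp add: Y_def matrix_add_ldistrib)
  have on: "(transpose A ** Y \<gamma>) $ j = sgn (X0 \<gamma> $ j)" if "j \<in> I" for \<gamma> j
    by (simp add: Y_split AG[OF that] Y0 C0 y(1)[OF that]) (simp add: C_def)
  \<comment> \<open>On \<open>I\<close> the limit row is nonzero because
    \<open>s $ j \<noteq> 0\<close>, so \<open>sgn\<close> is continuous there; outside
    \<open>I\<close> the rows are constantly zero.\<close>
  have C_lim: "((\<lambda>\<gamma>. C \<gamma> $ j) \<longlongrightarrow> C 0 $ j) (at_right 0)" for j
  proof (cases "j \<in> I")
    case True
    have "((\<lambda>\<gamma>. X0 \<gamma> $ j) \<longlongrightarrow> X0 0 $ j) (at_right 0)"
    proof (rule vec_tendstoI)
      fix k :: 2
      have "((\<lambda>\<gamma>. (1 - \<gamma>) * s $ j) \<longlongrightarrow> (1 - 0) * s $ j) (at_right 0)"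
        "((\<lambda>\<gamma>. \<gamma> * f $ j) \<longlongrightarrow> 0 * f $ j) (at_right 0)"
        by (intro tendsto_intros)+
      then show "((\<lambda>\<gamma>. X0 \<gamma> $ j $ k) \<longlongrightarrow> X0 0 $ j $ k) (at_right 0)"
        using exhaust_2[of k] by (auto simp: assms(7) two_columns_def)
    qed
    moreover have "X0 0 $ j \<noteq> 0"
      using True assms(2) by (auto simp: assms(7) two_columns_def support_def vec_eq_iff forall_2)
    ultimately show ?thesis
      unfolding C_def by (auto intro: tendsto_sgn)
  qed (simp add: C_def supp)
  have Y_lim: "((\<lambda>\<gamma>. (transpose A ** Y \<gamma>) $ j) \<longlongrightarrow> (transpose A ** Y 0) $ j) (at_right 0)" for j
    unfolding Y_def matrix_matrix_mult_def
    by (rule vec_tendstoI, simp only: vec_lambda_beta vector_add_component vector_minus_component,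
        intro tendsto_sum tendsto_mult tendsto_add tendsto_diff tendsto_const
          tendsto_vec_nth[OF C_lim])
  \<comment> \<open>The limit has norm \<open>\<bar>y \<bullet> column j A\<bar> < 1\<close>, and a
    strict bound on a limit holds eventually. There are finitely many \<open>j\<close>, so one
    neighbourhood serves all of them.\<close>
  have "\<forall>\<^sub>F \<gamma> in at_right 0. norm ((transpose A ** Y \<gamma>) $ j) < 1" if "j \<notin> I" for j
  proof -
    have "transpose A ** Y 0 = transpose A ** Y0"
      by (simp add: Y_def)
    then have "norm ((transpose A ** Y 0) $ j) < 1"
      using y(2)[OF that] by (simp add: Y0 norm_pair)
    with order_tendstoD(2)[OF tendsto_norm[OF Y_lim]] show ?thesis by blast
  qed
  then have "\<forall>\<^sub>F \<gamma> in at_right 0. \<forall>j. j \<notin> I \<longrightarrow> norm ((transpose A ** Y \<gamma>) $ j) < 1"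
    by (intro eventually_all_finite) simp
  then show ?thesis
    using eventually_at_right_less[of 0]
  proof eventually_elim
    case (elim \<gamma>)
    have "mixed_recovery_succeeds 2 A (X0 \<gamma>)"
      using on elim(1) supp G by (intro mixed_recovery_succeeds_2I[of I A "Y \<gamma>" _ G]) auto
    \<comment> \<open>The second column is \<open>\<gamma> *\<^sub>R f\<close> with
      \<open>\<gamma> > 0\<close>, so it inherits the failure of \<open>f\<close>.\<close>
    moreover have "\<not> mixed_recovery_succeeds 1 A (X0 \<gamma>)"
      using assms(3) elim(2) mixed_recovery_succeeds_1_two_columnsD
        l1_recovery_succeeds_scaleR_iff[of \<gamma> A f] unfolding assms(7) by blast
    ultimately show ?case ..
  qed
qed

end
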